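(* For every positive integer $d$, there is a number $c_d\in(0,1)$ and a function $\beta_d:(c_d,1]\to(0,1]$ such that the following holds: for every $S\subset\mathbb{R}^d$, every $\alpha\in(c_d,1]$, and every finite family $F$ of axis-parallel boxes in $\mathbb{R}^d$, if at least $\alpha\binom{|F|}{2}$ of the pairs of $F$ are $S$-intersecting, then $F$ contains an $S$-intersecting subfamily of size at least $\beta_d(\alpha)|F|$.
   Context: An axis-parallel box in $\mathbb{R}^d$ is a product of $d$ closed intervals of $\mathbb{R}$ (only closed boxes are considered). Given a nonempty set $S$, a family of nonempty sets is $S$-intersecting if the intersection of all its members meets $S$. A pair of $F$ is a subfamily of two members.
   Formalization: The family F is required not to consist of exactly one box: for |F| = 1 there are no pairs, so the hypothesis holds vacuously, while the conclusion fails if that box misses S. *)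

theory Defs
  imports "HOL-Analysis.Analysis"
begin

text \<open>
  Intervals are compact and nonempty; one-point intervals are allowed, so a box may have
  empty interior.
\<close>
definition axis_parallel_box :: "(real ^ 'n) set \<Rightarrow> bool" where
  "axis_parallel_box B \<longleftrightarrow> (\<exists>a b. (\<forall>i. a $ i \<le> b $ i) \<and> B = cbox a b)"

text \<open>The empty family has intersection \<^term>\<open>UNIV\<close>, so it is \<open>S\<close>-intersecting iff \<open>S\<close> is nonempty.\<close>
definition S_intersecting :: "'a set \<Rightarrow> 'a set set \<Rightarrow> bool" where
  "S_intersecting S G \<longleftrightarrow> \<Inter>G \<inter> S \<noteq> {}"

definition intersecting_pairs :: "'a set \<Rightarrow> 'a set set \<Rightarrow> 'a set set set" where
  "intersecting_pairs S F = {P. P \<subseteq> F \<and> card P = 2 \<and> S_intersecting S P}"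

end

(* Among sufficiently many boxes, Ramsey's theorem yields three, x, z, y in this order, along which
   each of the 2d endpoint sequences is monotone; then x \<inter> y \<subseteq> z. Count the m-tuples of members
   of F, for such an m: each contains a pair that is not S-intersecting, or a pair whose chosen
   common point in S lies in a third entry. If c is close to 1, the first kind makes up at most about
   half of all tuples, so on average the chosen point of a pair lies in a positive fraction
   of F. *)

theory Submission
  imports Defs "HOL-Library.Ramsey"
begin

section \<open>Three boxes in monotone position\<close>

text \<open>Both nondecreasing and decreasing sequences on \<open>B\<close> satisfy this. It is the
  consequence of monotonicity that the box argument uses, and it passes to subsets, as iterating
  Ramsey's theorem requires.\<close>

definition between_values :: "(nat \<Rightarrow> real) \<Rightarrow> nat set \<Rightarrow> bool" where
  "between_values u B \<longleftrightarrow> (\<forall>i\<in>B. \<forall>k\<in>B. \<forall>j\<in>B. i < k \<longrightarrow> k < j \<longrightarrow>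
    min (u i) (u j) \<le> u k \<and> u k \<le> max (u i) (u j))"

lemma between_values_subset: "between_values u B \<Longrightarrow> C \<subseteq> B \<Longrightarrow> between_values u C"
  unfolding between_values_def by blast

text \<open>Ramsey's theorem is applied once per label: the threshold \<open>r\<close> for
  \<open>insert l L\<close> is a Ramsey number for the threshold \<open>m\<close> of
  \<open>L\<close>, so the set found for \<open>l\<close> is still large enough for the remaining
  labels.\<close>

lemma finite_between_values_subset:
  fixes N :: nat
  assumes "finite L"
  shows "\<exists>m. \<forall>(u :: 'l \<Rightarrow> nat \<Rightarrow> real) A. finite A \<longrightarrow> m \<le> card A \<longrightarrow>
    (\<exists>B\<subseteq>A. N \<le> card B \<and> (\<forall>l\<in>L. between_values (u l) B))"
  using assms
proof (induction L rule: finite_induct)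
  case empty
  then show ?case by blast
next
  case (insert l L)
  from insert.IH obtain m where m: "\<forall>(u :: 'l \<Rightarrow> nat \<Rightarrow> real) A. finite A \<longrightarrow> m \<le> card A \<longrightarrow>
    (\<exists>B\<subseteq>A. N \<le> card B \<and> (\<forall>l\<in>L. between_values (u l) B))" ..
  obtain r where r: "\<forall>(V :: nat set) E. finite V \<and> r \<le> card V \<longrightarrow>
      (\<exists>R\<subseteq>V. card R = m \<and> clique R E \<or> card R = m \<and> indep R E)"
    using ramsey2[of m m, where 'a=nat] by (elim exE conjE)
  show ?case
  proof (rule exI[of _ r], intro allI impI)
    fix u :: "'l \<Rightarrow> nat \<Rightarrow> real" and A :: "nat set"
    assume A: "finite A" "r \<le> card A"
    \<comment> \<open>On a clique of \<open>E\<close> the sequence \<open>u l\<close> is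
      nondecreasing, on an independent set it is strictly decreasing.\<close>
    define E where "E = {{i, j} | i j. i < j \<and> u l i \<le> u l j}"
    have E: "{i, j} \<in> E \<longleftrightarrow> u l i \<le> u l j" if "i < j" for i j
      using that by (auto simp: E_def doubleton_eq_iff)
    obtain R where R: "R \<subseteq> A" "card R = m" "clique R E \<or> indep R E"
      using r[rule_format, of A E] A by blast
    have l: "between_values (u l) R"
      unfolding between_values_def
    proof (intro ballI impI)
      fix i k j assume ikj: "i \<in> R" "k \<in> R" "j \<in> R" "i < k" "k < j"
      then have "{i, k} \<in> E \<and> {k, j} \<in> E \<or> {i, k} \<notin> E \<and> {k, j} \<notin> E"
        using R(3) unfolding clique_def indep_def by (metis less_irrefl)
      then have "u l i \<le> u l k \<and> u l k \<le> u l j \<or> \<not> u l i \<le> u l k \<and> \<not> u l k \<le> u l j"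
        using E[of i k] E[of k j] ikj by blast
      then show "min (u l i) (u l j) \<le> u l k \<and> u l k \<le> max (u l i) (u l j)"
        by auto
    qed
    have "finite R"
      using R(1) A(1) finite_subset by blast
    then obtain B where B: "B \<subseteq> R" "N \<le> card B" "\<forall>l\<in>L. between_values (u l) B"
      using m[rule_format, of R u] R(2) by blast
    then show "\<exists>B\<subseteq>A. N \<le> card B \<and> (\<forall>l\<in>insert l L. between_values (u l) B)"
      using R(1) between_values_subset[OF l B(1)] by (intro exI[of _ B]) auto
  qed
qed

lemma ex_three_increasing:
  assumes "3 \<le> card (B :: nat set)"
  obtains i k j where "i \<in> B" "k \<in> B" "j \<in> B" "i < k" "k < j"
proof -
  obtain C where "C \<subseteq> B" "card C = 3"
    using assms by (metis obtain_subset_with_card_n)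
  then obtain x y z where "{x, y, z} \<subseteq> B" "x \<noteq> y" "y \<noteq> z" "x \<noteq> z"
    by (metis card_3_iff)
  then show ?thesis
    using that by (metis insert_subset linorder_neqE_nat)
qed

text \<open>In each coordinate the lower and upper endpoints of the middle box lie between those of
  the outer two, so it contains every point common to them. Indexed tuples allow repeated boxes, as
  the later count of all tuples requires.\<close>

lemma boxes_in_monotone_position:
  obtains m :: nat where "3 \<le> m"
    "\<And>f :: nat \<Rightarrow> (real ^ 'n) set. (\<And>i. i < m \<Longrightarrow> axis_parallel_box (f i)) \<Longrightarrow>
      \<exists>i k j. i < k \<and> k < j \<and> j < m \<and> f i \<inter> f j \<subseteq> f k"
proof -
  obtain m0 where m0: "\<forall>(u :: ('n \<times> bool) \<Rightarrow> nat \<Rightarrow> real) A. finite A \<longrightarrow> m0 \<le> card A \<longrightarrow>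
    (\<exists>B\<subseteq>A. 3 \<le> card B \<and> (\<forall>l\<in>UNIV. between_values (u l) B))"
    using finite_between_values_subset[OF finite, of 3 "UNIV :: ('n \<times> bool) set"] by (elim exE)
  define m where "m = max 3 m0"
  show thesis
  proof (rule that)
    show "3 \<le> m" by (simp add: m_def)
  next
    fix f :: "nat \<Rightarrow> (real ^ 'n) set"
    assume "\<And>i. i < m \<Longrightarrow> axis_parallel_box (f i)"
    then obtain a b where f: "\<And>i. i < m \<Longrightarrow> f i = cbox (a i) (b i)"
      unfolding axis_parallel_box_def by metis
    \<comment> \<open>One sequence for each coordinate and side: \<open>True\<close> selects lower
      endpoints, \<open>False\<close> upper ones.\<close>
    define u where "u = (\<lambda>(l :: 'n, s) i. if s then a i $ l else b i $ l)"
    obtain B where B: "B \<subseteq> {..<m}" "3 \<le> card B"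
      and u: "\<And>l. between_values (u l) B"
      using m0[rule_format, of "{..<m}" u] by (auto simp: m_def)
    obtain i k j where ikj: "i \<in> B" "k \<in> B" "j \<in> B" "i < k" "k < j"
      using ex_three_increasing[OF B(2)] .
    have lower: "a k $ l \<le> max (a i $ l) (a j $ l)"
      and upper: "min (b i $ l) (b j $ l) \<le> b k $ l" for l
      using u[of "(l, True)"] u[of "(l, False)"] ikj
      by (auto simp: u_def between_values_def)
    have "f i \<inter> f j \<subseteq> f k"
    proof
      fix x assume "x \<in> f i \<inter> f j"
      moreover have "i < m" "j < m" "k < m"
        using ikj B(1) by auto
      ultimately have x: "a i $ l \<le> x $ l \<and> x $ l \<le> b i $ l \<and> a j $ l \<le> x $ l \<and> x $ l \<le> b j $ l" for l
        by (auto simp: f mem_box_cart)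
      have "a k $ l \<le> x $ l \<and> x $ l \<le> b k $ l" for l
        using x[of l] lower[of l] upper[of l] by linarith
      then show "x \<in> f k"
        using \<open>k < m\<close> by (simp add: f mem_box_cart)
    qed
    then show "\<exists>i k j. i < k \<and> k < j \<and> j < m \<and> f i \<inter> f j \<subseteq> f k"
      using ikj B(1) by blast
  qed
qed

section \<open>Counting tuples\<close>

text \<open>Since \<open>\<phi> f\<close> determines the entries of \<open>f\<close> at
  \<open>I\<close>, the tuple is recovered from \<open>\<phi> f\<close> and its restriction to
  \<open>A - I\<close>.\<close>

lemma card_PiE_constrained_le:
  assumes "finite A" "finite F" "finite R" "I \<subseteq> A"
    and determined: "\<And>f g i. \<phi> f = \<phi> g \<Longrightarrow> i \<in> I \<Longrightarrow> f i = g i"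
  shows "card {f \<in> A \<rightarrow>\<^sub>E F. \<phi> f \<in> R} \<le> card R * card F ^ (card A - card I)"
proof -
  let ?T = "{f \<in> A \<rightarrow>\<^sub>E F. \<phi> f \<in> R}"
  let ?h = "\<lambda>f. (\<phi> f, restrict f (A - I))"
  have "inj_on ?h ?T"
  proof (rule inj_onI, rule ext)
    fix f g x
    assume fg: "f \<in> ?T" "g \<in> ?T" "?h f = ?h g"
    then have h: "\<phi> f = \<phi> g" "restrict f (A - I) = restrict g (A - I)"
      by simp_all
    have "f x = g x" if "x \<in> A - I"
      using fun_cong[OF h(2), of x] that by simp
    moreover have "f x = g x" if "x \<in> I"
      using that determined[OF h(1)] by simp
    \<comment> \<open>Outside \<open>A\<close> both extensional functions have the value
      \<open>undefined\<close>.\<close>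
    moreover have "f x = g x" if "x \<notin> A"
      using fg(1,2) PiE_arb[of f A "\<lambda>_. F" x] PiE_arb[of g A "\<lambda>_. F" x] that by simp
    ultimately show "f x = g x" by blast
  qed
  moreover have "?h ` ?T \<subseteq> R \<times> ((A - I) \<rightarrow>\<^sub>E F)"
    by (auto simp: PiE_mem)
  ultimately have "card ?T \<le> card (R \<times> ((A - I) \<rightarrow>\<^sub>E F))"
    using assms by (intro card_inj_on_le) (auto intro!: finite_PiE)
  then show ?thesis
    using assms by (simp add: card_cartesian_product card_funcsetE card_Diff_subset finite_subset)
qed

text \<open>A union bound over the positions of the pair or triple: fixing the entries at 2 or 3
  positions leaves \<open>m - 2\<close> or \<open>m - 3\<close> free ones, and there are at most
  \<open>m ^ 2\<close> or \<open>m ^ 3\<close> choices of positions. The common factor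
  \<open>card F ^ (m - 3)\<close> then cancels.\<close>

lemma tuple_counting:
  fixes P :: "'a \<Rightarrow> 'a \<Rightarrow> bool" and Q :: "'a \<Rightarrow> 'a \<Rightarrow> 'a \<Rightarrow> bool"
  assumes "finite F" "F \<noteq> {}" "3 \<le> m"
    and cover: "\<And>f. f \<in> {..<m} \<rightarrow>\<^sub>E F \<Longrightarrow>
      \<exists>i k j. i < k \<and> k < j \<and> j < m \<and> (P (f i) (f j) \<or> Q (f i) (f j) (f k))"
  shows "card F ^ 3 \<le> m ^ 2 * card {(x, y) \<in> F \<times> F. P x y} * card F
    + m ^ 3 * card {(x, y, z) \<in> F \<times> F \<times> F. Q x y z}"
proof -
  let ?n = "card F"
  let ?T = "{..<m} \<rightarrow>\<^sub>E F"
  let ?R = "{(x, y) \<in> F \<times> F. P x y}"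
  let ?W = "{(x, y, z) \<in> F \<times> F \<times> F. Q x y z}"
  define I where "I = {(i, j). i < j \<and> j < m}"
  define J where "J = {(i, k, j). i < k \<and> k < j \<and> j < m}"
  define TR where "TR = (\<lambda>(i, j). {f \<in> ?T. (f i, f j) \<in> ?R})"
  \<comment> \<open>The middle position \<open>k\<close> supplies the third argument of
    \<open>Q\<close>, hence the change of order.\<close>
  define TW where "TW = (\<lambda>(i, k, j). {f \<in> ?T. (f i, f j, f k) \<in> ?W})"
  have I: "I \<subseteq> {..<m} \<times> {..<m}" and J: "J \<subseteq> {..<m} \<times> {..<m} \<times> {..<m}"
    by (auto simp: I_def J_def)
  have fin: "finite I" "finite J"
    using finite_subset[OF I] finite_subset[OF J] by simp_all
  have cI: "card I \<le> m ^ 2"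
    using card_mono[OF _ I] by (simp add: power2_eq_square)
  have cJ: "card J \<le> m ^ 3"
    using card_mono[OF _ J] by (simp add: power3_eq_cube)
  have "card (TR p) \<le> card ?R * ?n ^ (m - 2)" if pI: "p \<in> I" for p
  proof -
    obtain i j where p: "p = (i, j)" "i < j" "j < m"
      using pI by (auto simp: I_def)
    have "finite ?R"
      by (rule finite_subset[of _ "F \<times> F"]) (use assms(1) in auto)
    then have "card {f \<in> ?T. (f i, f j) \<in> ?R} \<le> card ?R * ?n ^ (card {..<m} - card {i, j})"
      by (intro card_PiE_constrained_le) (use assms(1) p in auto)
    moreover have "card {i, j} = 2"
      using p by simp
    ultimately show ?thesis
      using p by (simp add: TR_def)
  qed
  then have cR: "(\<Sum>p\<in>I. card (TR p)) \<le> m ^ 2 * (card ?R * ?n ^ (m - 2))"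
    using sum_bounded_above[of I "\<lambda>p. card (TR p)"] mult_le_mono1[OF cI]
    by (metis (no_types, lifting) of_nat_id le_trans)
  have "card (TW p) \<le> card ?W * ?n ^ (m - 3)" if pJ: "p \<in> J" for p
  proof -
    obtain i k j where p: "p = (i, k, j)" "i < k" "k < j" "j < m"
      using pJ by (auto simp: J_def)
    have "finite ?W"
      by (rule finite_subset[of _ "F \<times> F \<times> F"]) (use assms(1) in auto)
    then have "card {f \<in> ?T. (f i, f j, f k) \<in> ?W} \<le> card ?W * ?n ^ (card {..<m} - card {i, j, k})"
      by (intro card_PiE_constrained_le) (use assms(1) p in auto)
    moreover have "card {i, j, k} = 3"
      using p by (simp add: numeral_3_eq_3)
    ultimately show ?thesis
      using p by (simp add: TW_def)
  qed
  then have cW: "(\<Sum>p\<in>J. card (TW p)) \<le> m ^ 3 * (card ?W * ?n ^ (m - 3))"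
    using sum_bounded_above[of J "\<lambda>p. card (TW p)"] mult_le_mono1[OF cJ]
    by (metis (no_types, lifting) of_nat_id le_trans)
  have "?T \<subseteq> (\<Union>p\<in>I. TR p) \<union> (\<Union>p\<in>J. TW p)"
  proof
    fix f assume f: "f \<in> ?T"
    obtain i k j where ikj: "i < k" "k < j" "j < m" "P (f i) (f j) \<or> Q (f i) (f j) (f k)"
      using cover[OF f] by blast
    have mem: "f i \<in> F" "f j \<in> F" "f k \<in> F"
      using PiE_mem[OF f] ikj(1-3) by simp_all
    have "f \<in> TR (i, j) \<or> f \<in> TW (i, k, j)"
      using f mem ikj(4) by (simp add: TR_def TW_def)
    moreover have "(i, j) \<in> I" "(i, k, j) \<in> J"
      using ikj(1-3) by (auto simp: I_def J_def)
    ultimately show "f \<in> (\<Union>p\<in>I. TR p) \<union> (\<Union>p\<in>J. TW p)" by blast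
  qed
  moreover have "finite ?T"
    using assms(1) by (simp add: finite_PiE)
  moreover from this have "finite ((\<Union>p\<in>I. TR p) \<union> (\<Union>p\<in>J. TW p))"
    using fin by (auto simp: TR_def TW_def)
  ultimately have "card ?T \<le> card (\<Union>p\<in>I. TR p) + card (\<Union>p\<in>J. TW p)"
    by (meson card_Un_le card_mono le_trans)
  also have "\<dots> \<le> (\<Sum>p\<in>I. card (TR p)) + (\<Sum>p\<in>J. card (TW p))"
    by (intro add_mono card_UN_le fin)
  also have "\<dots> \<le> m ^ 2 * (card ?R * ?n ^ (m - 2)) + m ^ 3 * (card ?W * ?n ^ (m - 3))"
    using cR cW by linarith
  finally have "?n ^ m \<le> m ^ 2 * (card ?R * ?n ^ (m - 2)) + m ^ 3 * (card ?W * ?n ^ (m - 3))"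
    by (simp add: card_funcsetE)
  \<comment> \<open>This form of \<open>m\<close> resolves the truncated subtractions in the
    exponents.\<close>
  moreover obtain q where q: "m = 3 + q"
    using assms(3) le_Suc_ex by blast
  have "?n ^ m = ?n ^ 3 * ?n ^ (m - 3)" "?n ^ (m - 2) = ?n * ?n ^ (m - 3)"
    by (simp_all add: q power_add)
  ultimately have "?n ^ 3 * ?n ^ (m - 3) \<le> (m ^ 2 * card ?R * ?n + m ^ 3 * card ?W) * ?n ^ (m - 3)"
    by (simp only: distrib_right mult.assoc)
  moreover have "0 < ?n ^ (m - 3)"
    using assms by (simp add: card_gt_0_iff)
  ultimately show ?thesis
    by (rule mult_right_le_imp_le)
qed

section \<open>Pairs that are not intersecting\<close>

lemma add_double_choose_two: "n + 2 * (n choose 2) = n * n"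
  by (cases n) (simp_all add: choose_two)

text \<open>The summand \<open>card F\<close> accounts for members of \<open>F\<close> that miss \<open>S\<close>; the factor 2 for the two
  orderings of a pair.\<close>
lemma card_disjoint_ordered_pairs_le:
  assumes "finite F"
  shows "card {(x, y) \<in> F \<times> F. x \<inter> y \<inter> S = {}} + 2 * card (intersecting_pairs S F)
    \<le> card F + 2 * (card F choose 2)"
proof -
  let ?D = "{(x, y) \<in> F \<times> F. x \<inter> y \<inter> S = {}}"
  let ?G = "{(x, y) \<in> F \<times> F. x \<noteq> y \<and> x \<inter> y \<inter> S \<noteq> {}}"
  let ?H = "intersecting_pairs S F"
  have finG: "finite ?G" and finD: "finite ?D"
    by (rule finite_subset[of _ "F \<times> F"]; use assms in auto)+
  have "2 * card ?H \<le> card ?G"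
  proof -
    have finH: "finite ?H"
      by (rule finite_subset[of _ "Pow F"]) (use assms in \<open>auto simp: intersecting_pairs_def\<close>)
    \<comment> \<open>The two orderings of a pair \<open>P\<close>; different pairs give disjoint
      sets of orderings.\<close>
    let ?f = "\<lambda>P. {(x, y). x \<noteq> y \<and> {x, y} = P}"
    have card_f: "card (?f P) = 2" if P: "P \<in> ?H" for P
    proof -
      obtain x y where "P = {x, y}" "x \<noteq> y"
        using P by (auto simp: intersecting_pairs_def card_2_iff)
      then have "?f P = {(x, y), (y, x)}"
        by (auto simp: doubleton_eq_iff)
      then show ?thesis using \<open>x \<noteq> y\<close> by simp
    qed
    have "card (\<Union>P\<in>?H. ?f P) = (\<Sum>P\<in>?H. card (?f P))"
      using finH card_f by (intro card_UN_disjoint) (auto intro: card_ge_0_finite)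
    also have "\<dots> = 2 * card ?H"
      using card_f by simp
    finally have "card (\<Union>P\<in>?H. ?f P) = 2 * card ?H" .
    moreover have "(\<Union>P\<in>?H. ?f P) \<subseteq> ?G"
    proof (rule subsetI)
      fix q assume "q \<in> (\<Union>P\<in>?H. ?f P)"
      then obtain x y where "q = (x, y)" "x \<noteq> y" "{x, y} \<in> ?H"
        by (cases q) blast
      then show "q \<in> ?G"
        by (simp add: intersecting_pairs_def S_intersecting_def)
    qed
    ultimately show ?thesis
      using card_mono[OF finG, of "\<Union>P\<in>?H. ?f P"] by simp
  qed
  moreover have "card ?D + card ?G \<le> card F * card F"
  proof -
    have "card (?D \<union> ?G) = card ?D + card ?G"
      using finD finG by (intro card_Un_disjoint) auto
    moreover have "card (?D \<union> ?G) \<le> card (F \<times> F)"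
      using assms by (intro card_mono) auto
    ultimately show ?thesis
      by (simp add: card_cartesian_product)
  qed
  ultimately show ?thesis
    using add_double_choose_two[of "card F"] by linarith
qed

text \<open>The dimension is the size of the finite type \<open>'n\<close>, hence positive. A single
  box that misses \<open>S\<close> satisfies the pair condition vacuously but violates the
  conclusion, which \<open>card F \<noteq> 1\<close> rules out. For empty \<open>F\<close> the only
  candidate is the empty subfamily, which is \<open>S\<close>-intersecting because
  \<open>S \<noteq> {}\<close>.\<close>

theorem theorem1p1:
  "\<exists>(c::real) (\<beta>::real \<Rightarrow> real).
     c \<in> {0<..<1} \<and> \<beta> \<in> {c<..1} \<rightarrow> {0<..1} \<and>
     (\<forall>(S::(real ^ 'n) set) \<alpha> (F::(real ^ 'n) set set).
        S \<noteq> {} \<longrightarrow> \<alpha> \<in> {c<..1} \<longrightarrow>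
        finite F \<longrightarrow> (\<forall>B\<in>F. axis_parallel_box B) \<longrightarrow> card F \<noteq> 1 \<longrightarrow>
        real (card (intersecting_pairs S F)) \<ge> \<alpha> * real (card F choose 2) \<longrightarrow>
        (\<exists>G\<subseteq>F. S_intersecting S G \<and> real (card G) \<ge> \<beta> \<alpha> * real (card F)))"
proof -
  obtain m :: nat where m: "3 \<le> m"
    and box: "\<And>f :: nat \<Rightarrow> (real ^ 'n) set. (\<And>i. i < m \<Longrightarrow> axis_parallel_box (f i)) \<Longrightarrow>
      \<exists>i k j. i < k \<and> k < j \<and> j < m \<and> f i \<inter> f j \<subseteq> f k"
    by (rule boxes_in_monotone_position) blast
  define M where "M = real m"
  have M: "3 \<le> M" using m by (simp add: M_def)
  \<comment> \<open>In the count below, \<open>c\<close> limits the non-intersecting pairs to about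
    half of \<open>n ^ 3\<close>, and \<open>\<beta>\<close>, constant in \<open>\<alpha>\<close>,
    limits the triples to a quarter. The last quarter has to absorb a term of order
    \<open>n ^ 2\<close>.\<close>
  define c where "c = 1 - 1 / (2 * M ^ 2)"
  define \<beta> where "\<beta> = 1 / (4 * M ^ 3)"
  have pow: "1 < 2 * M ^ 2" "1 < 4 * M ^ 3"
    using one_le_power[of M 2] one_le_power[of M 3] M by linarith+
  have c: "0 < c" "c < 1"
    using pow M by (auto simp: c_def)
  have \<beta>: "0 < \<beta>" "\<beta> \<le> 1"
    using pow M by (auto simp: \<beta>_def)
  have main: "\<exists>G\<subseteq>F. S_intersecting S G \<and> \<beta> * real (card F) \<le> real (card G)"
    if S: "S \<noteq> {}" and \<alpha>: "c < \<alpha>" and F: "finite F" "\<forall>B\<in>F. axis_parallel_box B" "card F \<noteq> 1"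
      and pairs: "\<alpha> * real (card F choose 2) \<le> real (card (intersecting_pairs S F))"
    for S :: "(real ^ 'n) set" and \<alpha> and F :: "(real ^ 'n) set set"
  proof (rule ccontr)
    assume "\<not> ?thesis"
    then have small: "real (card G) < \<beta> * real (card F)" if "G \<subseteq> F" "S_intersecting S G" for G
      using that by force
    define n where "n = real (card F)"
    have "F \<noteq> {}"
      using small[of "{}"] S by (auto simp: S_intersecting_def)
    then have "2 \<le> card F"
      using F(1,3) by (metis One_nat_def Suc_1 card_0_eq less_2_cases_iff linorder_not_less)
    then have n: "2 \<le> n"
      by (simp add: n_def)
    \<comment> \<open>Some intersecting pair exists and is itself a subfamily of size 2. Being too
      small for the conclusion, it forces \<open>n\<close> to be large, so small families need no
      separate treatment.\<close>
    have "0 < real (card F choose 2)"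
      using \<open>2 \<le> card F\<close> by (simp add: zero_less_binomial_iff)
    then have "0 < \<alpha> * real (card F choose 2)"
      using \<alpha> c by (intro mult_pos_pos) auto
    then have "intersecting_pairs S F \<noteq> {}"
      using pairs by force
    then obtain P where "P \<subseteq> F" "card P = 2" "S_intersecting S P"
      by (auto simp: intersecting_pairs_def)
    then have "2 < \<beta> * n"
      using small[of P] by (simp add: n_def)
    then have n_large: "8 * M ^ 3 < n"
      using M by (simp add: \<beta>_def field_simps)
    \<comment> \<open>One point of \<open>S\<close> is fixed for each intersecting pair. For other
      pairs the value is arbitrary, hence the guard in \<open>?W\<close>.\<close>
    define p where "p x y = (SOME q. q \<in> x \<inter> y \<inter> S)" for x y
    have p: "p x y \<in> x \<inter> y \<inter> S" if "x \<inter> y \<inter> S \<noteq> {}" for x y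
      unfolding p_def some_in_eq by (rule that)
    let ?R = "{(x, y) \<in> F \<times> F. x \<inter> y \<inter> S = {}}"
    let ?W = "{(x, y, z) \<in> F \<times> F \<times> F. x \<inter> y \<inter> S \<noteq> {} \<and> p x y \<in> z}"
    have "card F ^ 3 \<le> m ^ 2 * card ?R * card F + m ^ 3 * card ?W"
    proof (rule tuple_counting[OF F(1) \<open>F \<noteq> {}\<close> m])
      fix f assume f: "f \<in> {..<m} \<rightarrow>\<^sub>E F"
      have "\<exists>i k j. i < k \<and> k < j \<and> j < m \<and> f i \<inter> f j \<subseteq> f k"
        by (rule box) (use F(2) PiE_mem[OF f] in simp)
      then obtain i k j where ikj: "i < k" "k < j" "j < m" "f i \<inter> f j \<subseteq> f k"
        by (elim exE conjE)
      \<comment> \<open>The inclusion holds for all common points of the outer boxes, so also for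
        the chosen one.\<close>
      have "f i \<inter> f j \<inter> S = {} \<or> f i \<inter> f j \<inter> S \<noteq> {} \<and> p (f i) (f j) \<in> f k"
        using p[of "f i" "f j"] ikj(4) by blast
      with ikj(1-3) show "\<exists>i k j. i < k \<and> k < j \<and> j < m \<and>
          (f i \<inter> f j \<inter> S = {} \<or> f i \<inter> f j \<inter> S \<noteq> {} \<and> p (f i) (f j) \<in> f k)"
        by (intro exI[of _ i] exI[of _ k] exI[of _ j]) simp
    qed
    then have "real (card F ^ 3) \<le> real (m ^ 2 * card ?R * card F + m ^ 3 * card ?W)"
      by (rule of_nat_mono)
    then have count: "n ^ 3 \<le> M ^ 2 * real (card ?R) * n + M ^ 3 * real (card ?W)"
      by (simp add: n_def M_def)
    have "real (card ?W) \<le> n ^ 2 * (\<beta> * n)"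
    proof -
      \<comment> \<open>The fibre of \<open>?W\<close> over a pair: its members share the point
        \<open>p x y\<close> of \<open>S\<close>, so \<open>small\<close> applies. If the pair does
        not intersect in \<open>S\<close>, the fibre is empty.\<close>
      let ?Z = "\<lambda>(x, y). {z \<in> F. x \<inter> y \<inter> S \<noteq> {} \<and> p x y \<in> z}"
      have Z: "real (card (?Z xy)) \<le> \<beta> * n" for xy
      proof (cases xy)
        case (Pair x y)
        show ?thesis
        proof (cases "x \<inter> y \<inter> S = {}")
          case True
          then show ?thesis using Pair \<beta> n by simp
        next
          case False
          then have "S_intersecting S (?Z xy)"
            using p[of x y] Pair unfolding S_intersecting_def by (simp, blast)
          then show ?thesis
            using small[of "?Z xy"] Pair by (simp add: n_def)
        qed
      qed
      have "inj_on (\<lambda>(x, y, z). ((x, y), z)) ?W"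
        by (rule inj_onI) (simp split: prod.splits)
      moreover have "(\<lambda>(x, y, z). ((x, y), z)) ` ?W \<subseteq> (SIGMA xy:F \<times> F. ?Z xy)"
        by (simp add: image_subset_iff)
      moreover have "finite (SIGMA xy:F \<times> F. ?Z xy)"
        using F(1) by (intro finite_SigmaI) (simp_all split: prod.splits)
      ultimately have "card ?W \<le> card (SIGMA xy:F \<times> F. ?Z xy)"
        by (rule card_inj_on_le)
      also have "\<dots> = (\<Sum>xy\<in>F \<times> F. card (?Z xy))"
        using F(1) by (intro card_SigmaI) (simp_all split: prod.splits)
      finally have "real (card ?W) \<le> (\<Sum>xy\<in>F \<times> F. real (card (?Z xy)))"
        unfolding of_nat_sum[symmetric] of_nat_le_iff .
      also have "\<dots> \<le> real (card (F \<times> F)) * (\<beta> * n)"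
        using Z by (rule sum_bounded_above)
      finally show ?thesis
        by (simp add: card_cartesian_product n_def power2_eq_square)
    qed
    then have "M ^ 3 * real (card ?W) \<le> M ^ 3 * (n ^ 2 * (\<beta> * n))"
      using M by (intro mult_left_mono) auto
    also have "\<dots> = n ^ 3 / 4"
      using M by (simp add: \<beta>_def power2_eq_square power3_eq_cube)
    finally have W: "M ^ 3 * real (card ?W) \<le> n ^ 3 / 4" .
    \<comment> \<open>The summand \<open>n\<close> allows for the diagonal pairs; the other one
      comes from \<open>1 - \<alpha> < 1 / (2 * M ^ 2)\<close>.\<close>
    have "real (card ?R) \<le> n + n ^ 2 / (2 * M ^ 2)"
    proof -
      have two: "2 * real (card F choose 2) = n * (n - 1)"
        using arg_cong[OF add_double_choose_two[of "card F"], of real]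
        by (simp add: n_def algebra_simps)
      have "real (card ?R) + 2 * real (card (intersecting_pairs S F))
          \<le> n + 2 * real (card F choose 2)"
        using of_nat_mono[OF card_disjoint_ordered_pairs_le[OF F(1), of S], where 'a=real]
        by (simp add: n_def)
      then have "real (card ?R) \<le> n + (1 - \<alpha>) * (2 * real (card F choose 2))"
        using pairs by (simp add: left_diff_distrib)
      also have "\<dots> = n + (1 - \<alpha>) * (n * (n - 1))"
        by (simp only: two)
      also have "\<dots> \<le> n + 1 / (2 * M ^ 2) * (n * (n - 1))"
        using \<alpha> n by (intro add_left_mono mult_right_mono) (auto simp: c_def)
      also have "\<dots> \<le> n + 1 / (2 * M ^ 2) * n ^ 2"
        using n M by (intro add_left_mono mult_left_mono) (auto simp: power2_eq_square)
      finally show ?thesis by simp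
    qed
    then have "M ^ 2 * real (card ?R) * n \<le> M ^ 2 * (n + n ^ 2 / (2 * M ^ 2)) * n"
      using M n by (intro mult_left_mono mult_right_mono) auto
    also have "\<dots> = M ^ 2 * n ^ 2 + n ^ 3 / 2"
      using M by (simp add: field_simps power2_eq_square power3_eq_cube)
    \<comment> \<open>Half and a quarter of \<open>n ^ 3\<close> are moved to the left. The
      resulting bound \<open>n \<le> 4 * M ^ 2\<close> contradicts \<open>n_large\<close>.\<close>
    finally have "n ^ 3 \<le> 4 * (M ^ 2 * n ^ 2)"
      using count W by linarith
    then have "n ^ 2 * n \<le> n ^ 2 * (4 * M ^ 2)"
      by (simp add: power2_eq_square power3_eq_cube mult_ac)
    then have "n \<le> 4 * M ^ 2"
      using n by simp
    moreover have "M ^ 2 \<le> M ^ 3"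
      using M by (intro power_increasing) auto
    ultimately show False
      using n_large pow by linarith
  qed
  show ?thesis
    using c \<beta> main by (intro exI[of _ c] exI[of _ "\<lambda>_. \<beta>"]) auto
qed

end
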